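(* Let $\beta,\gamma,\lambda\in\mathbb{R}$ with $(\lambda,\gamma)\neq(0,0)$, and for real parameters let $H_n(\lambda,\beta,\gamma)$ denote the coefficient of $\frac{x^n}{n!}$ in the power series $\frac{e^{\gamma x}}{(2-e^{\beta x})^{\lambda}}$. Then for every $n\in\mathbb{N}_0$, $$\sum_{k=0}^{n}\sum_{s=0}^{k}\binom{k}{s}(-1)^{k-s}H_n(\lambda-1,\beta,\gamma+\beta s)=\sum_{s=0}^{\infty}\frac{H_n(\lambda-1,\beta,\gamma+\beta s)}{2^{s+1}}.$$
   Context: Since $2-e^{\beta x}$ has constant term $1$, $(2-e^{\beta x})^{-\lambda}$ is a well-defined formal power series for all real $\lambda$. *)

theory Defs
  imports "HOL-Analysis.Analysis"
begin

(* Real power f^a of a formal power series with constant term 1, as the binomial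
   series sum_k (a gchoose k) (f - 1)^k.  Only meaningful if fps_nth f 0 = 1. *)
definition fps_rpow :: "real fps \<Rightarrow> real \<Rightarrow> real fps" where
  "fps_rpow f a = fps_compose (fps_binomial a) (f - 1)"

lemma fps_rpow_of_nat:
  assumes "fps_nth f 0 = 1"
  shows "fps_rpow f (of_nat k) = f ^ k"
proof -
  have 0: "fps_nth (f - 1) 0 = 0" using assms by simp
  show ?thesis
    unfolding fps_rpow_def fps_binomial_of_nat
    by (subst fps_compose_power[OF 0, symmetric]) (use assms in \<open>simp add: fps_compose_add_distrib fps_X_fps_compose_startby0\<close>)
qed

lemma fps_rpow_add:
  assumes "fps_nth f 0 = 1"
  shows "fps_rpow f (a + b) = fps_rpow f a * fps_rpow f b"
  using assms by (simp add: fps_rpow_def fps_binomial_add_mult fps_compose_mult_distrib)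

definition H :: "nat \<Rightarrow> real \<Rightarrow> real \<Rightarrow> real \<Rightarrow> real" where
  "H n lam \<beta> \<gamma> = fact n * fps_nth (fps_exp \<gamma> / fps_rpow (2 - fps_exp \<beta>) lam) n"

end

(* Put E = e^(beta x) - 1 and let G be the series generating H n (lam - 1) beta gamma.
   Expanding e^(s beta x) = (1 + E)^s and, conversely, E^k = (e^(beta x) - 1)^k with the
   binomial theorem shows that the inner sum over s on the right is d k = n! [x^n] G E^k and
   that H n (lam - 1) beta (gamma + beta s) is the sum of (s choose k) d k over k. As E has
   no constant term, d k = 0 for k > n, and the sum over s of (s choose k) / 2^(s + 1) is 1. *)

theory Submission
  imports Defs
begin

text \<open>This is the negative binomial series for (1 + x) powr -(k + 1) at x = -1/2, rescaled and
  reindexed by s = m + k.\<close>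

lemma sums_choose_half_power:
  "(\<lambda>s. real (s choose k) / 2 ^ (s + 1)) sums 1"
proof -
  have "(\<lambda>m. (- real (k + 1) gchoose m) * (- (1 / 2)) ^ m) sums (1 + - (1 / 2)) powr (- real (k + 1))"
    by (rule gen_binomial_real) simp
  moreover have "(- real (k + 1) gchoose m) * (- (1 / 2)) ^ m = real (m + k choose k) / 2 ^ m" for m
  proof -
    \<comment> \<open>Negating the upper index -(k + 1) gives k + 1 + m - 1, a natural number, so
      the generalized coefficient becomes an ordinary one.\<close>
    have "real (k + 1) + real m - 1 = real (m + k)"
      by simp
    then have "(- real (k + 1) gchoose m) = (- 1) ^ m * real (m + k choose m)"
      by (simp only: gbinomial_minus binomial_gbinomial)
    moreover have "(- (1 / 2 :: real)) ^ m = (- 1) ^ m / 2 ^ m"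
      by (subst power_minus) (simp add: power_divide)
    moreover have "(m + k choose m) = (m + k choose k)"
      using binomial_symmetric[of m "m + k"] by simp
    ultimately show ?thesis
      by (simp flip: power_mult_distrib)
  qed
  moreover have "(1 + - (1 / 2) :: real) powr (- real (k + 1)) = 2 ^ (k + 1)"
    by (subst powr_minus, subst powr_realpow) (simp_all add: power_divide)
  ultimately have "(\<lambda>m. real (m + k choose k) / 2 ^ m) sums 2 ^ (k + 1)"
    by simp
  from sums_divide[OF this, of "2 ^ (k + 1)"]
  have "(\<lambda>m. real (m + k choose k) / 2 ^ (m + k + 1)) sums 1"
    by (simp add: power_add mult_ac)
  \<comment> \<open>The shift by k drops only the terms with s < k, where s choose k is 0.\<close>
  then show ?thesis
    by (subst (asm) sums_iff_shift) (simp add: binomial_eq_0)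
qed

lemma fps_exp_of_nat_mult:
  "fps_exp (b * real s) = (fps_exp b :: real fps) ^ s"
  by (simp add: fps_exp_power_mult mult.commute)

text \<open>It makes the denominator in \<open>H\<close> a unit, so that the division is
  multiplication by an inverse and factors of the numerator can be moved out.\<close>

lemma fps_rpow_nth_0: "fps_nth (fps_rpow f a) 0 = 1"
  by (simp add: fps_rpow_def)

lemma H_add_mult_of_nat:
  "H n a \<beta> (\<gamma> + \<beta> * real s) =
    fact n * fps_nth (fps_exp \<gamma> / fps_rpow (2 - fps_exp \<beta>) a * fps_exp \<beta> ^ s) n"
  by (simp add: H_def fps_rpow_nth_0 fps_divide_unit fps_exp_add_mult fps_exp_of_nat_mult mult_ac)

lemma fps_nth_mult_power_eq_0:
  fixes E G :: "'a::comm_ring_1 fps"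
  assumes "fps_nth E 0 = 0" and "n < k"
  shows "fps_nth (G * E ^ k) n = 0"
  using assms by (auto simp: fps_mult_nth startsby_zero_power_prefix intro!: sum.neutral)

theorem theorem12:
  fixes lam \<beta> \<gamma> :: real and n :: nat
  assumes "(lam, \<gamma>) \<noteq> (0, 0)"
  shows "(\<lambda>s. H n (lam - 1) \<beta> (\<gamma> + \<beta> * real s) / 2 ^ (s + 1)) sums
    (\<Sum>k=0..n. \<Sum>s=0..k. real (k choose s) * (-1) ^ (k - s) * H n (lam - 1) \<beta> (\<gamma> + \<beta> * real s))"
proof -
  define G where "G = fps_exp \<gamma> / fps_rpow (2 - fps_exp \<beta>) (lam - 1)"
  define E where "E = fps_exp \<beta> - 1"
  define d where "d k = fact n * fps_nth (G * E ^ k) n" for k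
  have H_eq: "H n (lam - 1) \<beta> (\<gamma> + \<beta> * real s) = fact n * fps_nth (G * fps_exp \<beta> ^ s) n" for s
    by (simp only: H_add_mult_of_nat G_def)
  have nth_of_nat_mult: "fps_nth (of_nat m * f) n = real m * fps_nth f n" for m and f :: "real fps"
    by (simp add: fps_of_nat[symmetric])
  have difference: "(\<Sum>s=0..k. real (k choose s) * (-1) ^ (k - s) * H n (lam - 1) \<beta> (\<gamma> + \<beta> * real s)) = d k" for k
  proof -
    have "E ^ k = (fps_exp \<beta> + - 1) ^ k"
      by (simp add: E_def)
    also have "\<dots> = (\<Sum>s\<le>k. of_nat (k choose s) * fps_exp \<beta> ^ s * (- 1) ^ (k - s))"
      by (rule binomial_ring)
    finally have "G * E ^ k =
        (\<Sum>s=0..k. fps_const (real (k choose s) * (-1) ^ (k - s)) * (G * fps_exp \<beta> ^ s))"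
      by (simp add: sum_distrib_left atLeast0AtMost mult_ac fps_of_nat[symmetric]
          flip: fps_const_mult fps_const_power fps_const_neg)
    then show ?thesis
      by (simp add: d_def H_eq fps_sum_nth sum_distrib_left) (simp add: mult_ac)
  qed
  have newton: "H n (lam - 1) \<beta> (\<gamma> + \<beta> * real s) = (\<Sum>k=0..n. real (s choose k) * d k)" for s
  proof -
    have "fps_exp \<beta> ^ s = (E + 1) ^ s"
      by (simp add: E_def)
    also have "\<dots> = (\<Sum>k\<le>s. of_nat (s choose k) * E ^ k)"
      by (simp add: binomial_ring)
    finally have "G * fps_exp \<beta> ^ s = (\<Sum>k\<le>s. of_nat (s choose k) * (G * E ^ k))"
      by (simp add: sum_distrib_left mult_ac)
    then have "H n (lam - 1) \<beta> (\<gamma> + \<beta> * real s) = (\<Sum>k\<le>s. real (s choose k) * d k)"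
      by (simp add: H_eq fps_sum_nth nth_of_nat_mult d_def sum_distrib_left) (simp add: mult_ac)
    \<comment> \<open>The bound s is exchanged for n through their maximum: terms with k > s vanish
      by the binomial coefficient, terms with k > n by \<open>d k = 0\<close>.\<close>
    also have "\<dots> = (\<Sum>k\<le>max s n. real (s choose k) * d k)"
      by (rule sum.mono_neutral_left) (auto simp: binomial_eq_0)
    also have "\<dots> = (\<Sum>k=0..n. real (s choose k) * d k)"
      by (rule sum.mono_neutral_right) (auto simp: d_def E_def fps_nth_mult_power_eq_0)
    finally show ?thesis .
  qed
  \<comment> \<open>As the range of k no longer depends on s, the series over s is a finite sum of
    convergent series, and each \<open>d k\<close> gets total weight 1.\<close>
  have "(\<lambda>s. \<Sum>k=0..n. d k * (real (s choose k) / 2 ^ (s + 1))) sums (\<Sum>k=0..n. d k * 1)"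
    by (intro sums_sum sums_mult sums_choose_half_power)
  then show ?thesis
    unfolding difference unfolding newton by (simp add: sum_divide_distrib mult_ac)
qed

end
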